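(* Let $(X,w)$ be a weighted graph which is a $[-1,\lambda]$-expander and let $R$ be a nontrivial abelian group. Then $$\mathrm{cbe}_0(X,w,R_X)\geq 1-\lambda .$$
   Context: A graph is a finite simplicial complex $X$ of dimension at most $1$ (a nonempty finite family of finite sets closed under taking subsets, so $\emptyset\in X$). $X(i)$ denotes the set of faces of dimension $i$ (cardinality $i+1$); $X(0)$ is the set of vertices and $X(1)$ the set of edges. A weighted graph is a pair $(X,w)$ where $X$ is a graph that is pure of dimension $1$ (every face is contained in an edge) and $w:X\to[0,\infty)$ satisfies $\sum_{e\in X(1)}w(e)=1$, $w(v)=\frac12\sum_{e\in X(1),\,e\supseteq v}w(e)$ for all $v\in X(0)$, $w(\emptyset)=1$, and $w(v)>0$ for all $v\in X(0)$. For $A\subseteq X$, $w(A)=\sum_{a\in A}w(a)$. Spectral expansion: $C^0(X,\mathbb{R})$ is the space of functions $f:X(0)\to\mathbb{R}$ with inner product $\langle f,g\rangle=\sum_{v\in X(0)}w(v)f(v)g(v)$. The weighted adjacency operator is $(\mathcal{A}f)(v)=\sum_{e\in X(1),\,e\supseteq v}\frac{w(e)}{2w(v)}f(e-v)$, where $e-v$ is the other vertex of $e$. $\mathcal{A}$ is self-adjoint and preserves $C^0_\circ(X,\mathbb{R})=\{f:\sum_v w(v)f(v)=0\}$. For real $\mu\le\lambda$, $(X,w)$ is a $[\mu,\lambda]$-expander if all eigenvalues of $\mathcal{A}$ on $C^0_\circ(X,\mathbb{R})$ lie in $[\mu,\lambda]$. Coboundary expansion with constant coefficients: fix a linear order on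 the vertices and, for an edge $e$, let $e^+$ and $e^-$ be its larger and smaller vertex. Let $C^0=R^{X(0)}$, $C^1=R^{X(1)}$, $(d_0f)(e)=f(e^+)-f(e^-)$, and let $B^0\subseteq C^0$ be the set of constant functions. For $f\in C^i$ put $\|f\|_w=w(\{x\in X(i): f(x)\neq 0\})$ and $\mathrm{dist}_w(f,B^0)=\min_{g\in B^0}\|f-g\|_w$. Then $\mathrm{cbe}_0(X,w,R_X)$ is the supremum of all $\varepsilon\in[0,\infty)$ such that $\|d_0f\|_w\ge\varepsilon\,\mathrm{dist}_w(f,B^0)$ for all $f\in C^0$. *)

theory Defs
  imports "HOL-Library.Extended_Real"
begin

text \<open>
  Graphs are simplicial complexes, i.e. families of finite sets. Accordingly a vertex is a face
  of dimension 0 (a singleton) and not an element of the ground type.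
\<close>

definition faces :: "'a set set \<Rightarrow> nat \<Rightarrow> 'a set set" where
  "faces X i = {x \<in> X. finite x \<and> card x = i + 1}"

definition is_graph :: "'a set set \<Rightarrow> bool" where
  "is_graph X \<longleftrightarrow>
     finite X \<and> X \<noteq> {} \<and> (\<forall>x\<in>X. finite x) \<and> (\<forall>x\<in>X. \<forall>y. y \<subseteq> x \<longrightarrow> y \<in> X) \<and>
     (\<forall>x\<in>X. card x \<le> 2)"

definition pure1 :: "'a set set \<Rightarrow> bool" where
  "pure1 X \<longleftrightarrow> (\<forall>x\<in>X. \<exists>e\<in>faces X 1. x \<subseteq> e)"

definition weighted_graph :: "'a set set \<Rightarrow> ('a set \<Rightarrow> real) \<Rightarrow> bool" where
  "weighted_graph X w \<longleftrightarrow>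
     is_graph X \<and> pure1 X \<and> (\<forall>x\<in>X. 0 \<le> w x) \<and>
     (\<Sum>e\<in>faces X 1. w e) = 1 \<and>
     (\<forall>v\<in>faces X 0. w v = 1/2 * (\<Sum>e | e \<in> faces X 1 \<and> v \<subseteq> e. w e)) \<and>
     w {} = 1 \<and>
     (\<forall>v\<in>faces X 0. 0 < w v)"


text \<open>
  A cochain in dimension \<open>i\<close> is represented by a total function on sets of which only the values
  on \<open>faces X i\<close> matter; in particular, it is zero iff it vanishes on \<open>faces X i\<close>.
\<close>

definition adjacency_op ::
    "'a set set \<Rightarrow> ('a set \<Rightarrow> real) \<Rightarrow> ('a set \<Rightarrow> real) \<Rightarrow> 'a set \<Rightarrow> real" where
  "adjacency_op X w f v =
     (\<Sum>e | e \<in> faces X 1 \<and> v \<subseteq> e. w e / (2 * w v) * f (e - v))"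

definition C0_circ :: "'a set set \<Rightarrow> ('a set \<Rightarrow> real) \<Rightarrow> ('a set \<Rightarrow> real) set" where
  "C0_circ X w = {f. (\<Sum>v\<in>faces X 0. w v * f v) = 0}"

definition adjacency_eigenvalue_on_C0_circ ::
    "'a set set \<Rightarrow> ('a set \<Rightarrow> real) \<Rightarrow> real \<Rightarrow> bool" where
  "adjacency_eigenvalue_on_C0_circ X w \<theta> \<longleftrightarrow>
     (\<exists>f\<in>C0_circ X w. (\<exists>v\<in>faces X 0. f v \<noteq> 0) \<and>
        (\<forall>v\<in>faces X 0. adjacency_op X w f v = \<theta> * f v))"

definition expander :: "real \<Rightarrow> real \<Rightarrow> 'a set set \<Rightarrow> ('a set \<Rightarrow> real) \<Rightarrow> bool" where
  "expander \<mu> lam X w \<longleftrightarrow>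
     \<mu> \<le> lam \<and> (\<forall>\<theta>. adjacency_eigenvalue_on_C0_circ X w \<theta> \<longrightarrow> \<theta> \<in> {\<mu>..lam})"


text \<open>
  The linear order on the vertices is a relation \<open>r\<close> on \<open>faces X 0\<close>, where \<open>(u, v) \<in> r\<close> means
  that \<open>u\<close> is at most \<open>v\<close>.
\<close>

definition larger_vertex :: "'a set set \<Rightarrow> 'a set rel \<Rightarrow> 'a set \<Rightarrow> 'a set" where
  "larger_vertex X r e =
     (THE v. v \<in> faces X 0 \<and> v \<subseteq> e \<and> (\<forall>u\<in>faces X 0. u \<subseteq> e \<longrightarrow> (u, v) \<in> r))"

definition smaller_vertex :: "'a set set \<Rightarrow> 'a set rel \<Rightarrow> 'a set \<Rightarrow> 'a set" where
  "smaller_vertex X r e =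
     (THE v. v \<in> faces X 0 \<and> v \<subseteq> e \<and> (\<forall>u\<in>faces X 0. u \<subseteq> e \<longrightarrow> (v, u) \<in> r))"

definition d0 ::
    "'a set set \<Rightarrow> 'a set rel \<Rightarrow> ('a set \<Rightarrow> 'r::ab_group_add) \<Rightarrow> 'a set \<Rightarrow> 'r" where
  "d0 X r f e = f (larger_vertex X r e) - f (smaller_vertex X r e)"

definition B0 :: "'a set set \<Rightarrow> ('a set \<Rightarrow> 'r::ab_group_add) set" where
  "B0 X = {g. \<exists>c. \<forall>v\<in>faces X 0. g v = c}"

definition wnorm ::
    "'a set set \<Rightarrow> ('a set \<Rightarrow> real) \<Rightarrow> nat \<Rightarrow> ('a set \<Rightarrow> 'r::ab_group_add) \<Rightarrow> real" where
  "wnorm X w i f = sum w {x \<in> faces X i. f x \<noteq> 0}"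

text \<open>
  \<open>B0 X\<close> may be infinite, but for a finite \<open>X\<close> the norm takes only finitely many values, so
  \<open>Min\<close> is applied to a finite nonempty set.
\<close>

definition dist_B0 ::
    "'a set set \<Rightarrow> ('a set \<Rightarrow> real) \<Rightarrow> ('a set \<Rightarrow> 'r::ab_group_add) \<Rightarrow> real" where
  "dist_B0 X w f = Min ((\<lambda>g. wnorm X w 0 (\<lambda>v. f v - g v)) ` B0 X)"

text \<open>
  The coefficient group is the type argument. The supremum is taken in the extended reals,
  since the set is unbounded for the trivial group.
\<close>

definition cbe0 ::
    "'a set set \<Rightarrow> ('a set \<Rightarrow> real) \<Rightarrow> 'a set rel \<Rightarrow> 'r::ab_group_add itself \<Rightarrow> ereal" where
  "cbe0 X w r R =
     Sup {ereal \<epsilon> | \<epsilon>. 0 \<le> \<epsilon> \<and>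
       (\<forall>f :: 'a set \<Rightarrow> 'r. wnorm X w 1 (d0 X r f) \<ge> \<epsilon> * dist_B0 X w f)}"

end

(*
  By the Rayleigh principle an indicator function of a vertex set of weight p satisfies
  <A 1, 1> <= p^2 + lam (p - p^2). For a cochain f with values in R, apply this to the level sets
  of f, of weights p_c. An edge is not in the support of d_0 f iff both ends lie in one level set,
  so summing over c yields 1 - ||d_0 f|| <= S + lam (1 - S) with S = sum_c p_c^2. Since the p_c
  sum to 1 and subtracting the constant c gives dist(f, B^0) <= 1 - p_c, also
  S <= 1 - dist(f, B^0), hence ||d_0 f|| >= (1 - lam) dist(f, B^0) when lam <= 1. For lam > 1 the
  bound is trivial, as 0 is always an admissible constant.
*)

theory Submission
  imports Defs "HOL-Analysis.Function_Topology"
begin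

section \<open>The weighted inner product\<close>

text \<open>The index set is arbitrary, so the spectral argument stays free of graphs; at
  \<open>V = faces X 0\<close> this is the inner product of C^0.\<close>

definition w_inner :: "'b set \<Rightarrow> ('b \<Rightarrow> real) \<Rightarrow> ('b \<Rightarrow> real) \<Rightarrow> ('b \<Rightarrow> real) \<Rightarrow> real" where
  "w_inner V w f g = (\<Sum>v\<in>V. w v * f v * g v)"

lemma w_inner_cong:
  assumes "\<And>v. v \<in> V \<Longrightarrow> f v = f' v" and "\<And>v. v \<in> V \<Longrightarrow> g v = g' v"
  shows "w_inner V w f g = w_inner V w f' g'"
  unfolding w_inner_def by (rule sum.cong) (simp_all add: assms)

lemma w_inner_commute: "w_inner V w f g = w_inner V w g f"
  unfolding w_inner_def by (simp add: mult.commute mult.left_commute)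

lemma w_inner_add_left:
  "w_inner V w (\<lambda>v. f v + g v) h = w_inner V w f h + w_inner V w g h"
  unfolding w_inner_def by (simp add: algebra_simps sum.distrib)

lemma w_inner_scale_left:
  "w_inner V w (\<lambda>v. c * f v) h = c * w_inner V w f h"
  unfolding w_inner_def by (simp add: sum_distrib_left algebra_simps)

lemma w_inner_add_right:
  "w_inner V w h (\<lambda>v. f v + g v) = w_inner V w h f + w_inner V w h g"
  unfolding w_inner_def by (simp add: algebra_simps sum.distrib)

lemma w_inner_scale_right:
  "w_inner V w h (\<lambda>v. c * f v) = c * w_inner V w h f"
  unfolding w_inner_def by (simp add: sum_distrib_left algebra_simps)

lemmas w_inner_simps =
  w_inner_add_left w_inner_add_right w_inner_scale_left w_inner_scale_right

lemma w_inner_self_nonneg: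
  assumes "\<And>v. v \<in> V \<Longrightarrow> 0 < w v"
  shows "0 \<le> w_inner V w f f"
  unfolding w_inner_def using assms
  by (intro sum_nonneg) (simp add: less_imp_le mult.assoc)

lemma w_inner_self_eq_0_iff:
  assumes "finite V" and "\<And>v. v \<in> V \<Longrightarrow> 0 < w v"
  shows "w_inner V w f f = 0 \<longleftrightarrow> (\<forall>v\<in>V. f v = 0)"
proof -
  have "w_inner V w f f = 0 \<longleftrightarrow> (\<forall>v\<in>V. w v * f v * f v = 0)"
    unfolding w_inner_def using assms
    by (intro sum_nonneg_eq_0_iff) (simp_all add: less_imp_le mult.assoc)
  also have "\<dots> \<longleftrightarrow> (\<forall>v\<in>V. f v = 0)"
    using assms(2) by fastforce
  finally show ?thesis .
qed

section \<open>Compactness and the Rayleigh principle\<close>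

lemma continuous_on_w_inner:
  assumes "\<And>v. v \<in> V \<Longrightarrow> continuous_on S (\<lambda>x. f x v)"
    and "\<And>v. v \<in> V \<Longrightarrow> continuous_on S (\<lambda>x. g x v)"
  shows "continuous_on S (\<lambda>x. w_inner V w (f x) (g x))"
  unfolding w_inner_def by (intro continuous_intros assms)

text \<open>With values fixed to 0 outside \<open>V\<close>, every coordinate is confined to a
  compact interval, so the set is a closed part of a product that is compact by Tychonoff's
  theorem.\<close>

lemma compact_w_unit_sphere:
  fixes w :: "'b \<Rightarrow> real"
  assumes "finite V" and pos: "\<And>v. v \<in> V \<Longrightarrow> 0 < w v"
  shows "compact {g. (\<forall>v. v \<notin> V \<longrightarrow> g v = 0) \<and> w_inner V w g (\<lambda>_. 1) = 0 \<and> w_inner V w g g = 1}"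
proof -
  \<comment> \<open>A single summand of \<open>w_inner V w g g = 1\<close> gives
    \<open>w v * (g v)^2 \<le> 1\<close>; hence the radius \<open>1 / sqrt (w v)\<close>.\<close>
  define B where "B v = (if v \<in> V then {- (1 / sqrt (w v))..1 / sqrt (w v)} else {0})" for v
  have coord: "continuous_on UNIV (\<lambda>g :: 'b \<Rightarrow> real. g v)" for v
    by (rule continuous_on_product_coordinates)
  have "compactin (product_topology (\<lambda>_. euclidean) UNIV) (PiE UNIV B)"
    unfolding compactin_PiE by (simp add: B_def)
  then have "compact (PiE UNIV B)"
    by (simp add: euclidean_product_topology)
  moreover have "closed ({g. w_inner V w g (\<lambda>_. 1) = 0} \<inter> {g. w_inner V w g g = 1})"
    by (intro closed_Int closed_Collect_eq continuous_on_w_inner coord continuous_on_const)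
  ultimately have "compact
      (PiE UNIV B \<inter> ({g. w_inner V w g (\<lambda>_. 1) = 0} \<inter> {g. w_inner V w g g = 1}))"
    by (rule compact_Int_closed)
  also have "PiE UNIV B \<inter> ({g. w_inner V w g (\<lambda>_. 1) = 0} \<inter> {g. w_inner V w g g = 1})
      = {g. (\<forall>v. v \<notin> V \<longrightarrow> g v = 0) \<and> w_inner V w g (\<lambda>_. 1) = 0 \<and> w_inner V w g g = 1}"
  proof -
    have "g v \<in> {- (1 / sqrt (w v))..1 / sqrt (w v)}"
      if "v \<in> V" and g: "w_inner V w g g = 1" for g v
    proof -
      have "w v * g v * g v \<le> w_inner V w g g"
        unfolding w_inner_def using assms that(1)
        by (intro member_le_sum) (auto simp: less_imp_le mult.assoc)
      then have "(g v)\<^sup>2 \<le> 1 / w v"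
        using g pos[OF that(1)] by (simp add: field_simps power2_eq_square)
      then have "\<bar>g v\<bar> \<le> 1 / sqrt (w v)"
        by (metis real_sqrt_abs real_sqrt_divide real_sqrt_le_iff real_sqrt_one)
      then show ?thesis by (auto simp: abs_le_iff)
    qed
    then show ?thesis
      unfolding B_def by (fastforce simp: PiE_UNIV_domain Pi_iff split: if_splits)
  qed
  finally show ?thesis .
qed

text \<open>
  The Rayleigh quotient attains its maximum on the unit sphere of the orthogonal complement of
  the constants, and a maximiser is an eigenvector there.
\<close>

lemma rayleigh_le:
  fixes w :: "'b \<Rightarrow> real" and T :: "('b \<Rightarrow> real) \<Rightarrow> 'b \<Rightarrow> real"
  assumes fin: "finite V" and pos: "\<And>v. v \<in> V \<Longrightarrow> 0 < w v"
    and cont: "\<And>v. v \<in> V \<Longrightarrow> continuous_on UNIV (\<lambda>f. T f v)"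
    and local: "\<And>f g v. (\<And>u. u \<in> V \<Longrightarrow> f u = g u) \<Longrightarrow> v \<in> V \<Longrightarrow> T f v = T g v"
    and linear: "\<And>f g c v. v \<in> V \<Longrightarrow> T (\<lambda>u. f u + c * g u) v = T f v + c * T g v"
    and selfadj: "\<And>f g. w_inner V w (T f) g = w_inner V w f (T g)"
    and invariant: "\<And>f. w_inner V w f (\<lambda>_. 1) = 0 \<Longrightarrow> w_inner V w (T f) (\<lambda>_. 1) = 0"
    and eig: "\<And>\<theta> f. w_inner V w f (\<lambda>_. 1) = 0 \<Longrightarrow> \<exists>v\<in>V. f v \<noteq> 0 \<Longrightarrow>
                \<forall>v\<in>V. T f v = \<theta> * f v \<Longrightarrow> \<theta> \<le> lam"
    and f: "w_inner V w f (\<lambda>_. 1) = 0"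
  shows "w_inner V w (T f) f \<le> lam * w_inner V w f f"
proof (cases "w_inner V w f f = 0")
  case True
  then have "\<forall>v\<in>V. f v = 0"
    using w_inner_self_eq_0_iff[of V w, OF fin pos] by blast
  then have "w_inner V w (T f) f = 0"
    unfolding w_inner_def by simp
  with True show ?thesis by simp
next
  case False
  define K where "K = {g. (\<forall>v. v \<notin> V \<longrightarrow> g v = 0) \<and> w_inner V w g (\<lambda>_. 1) = 0 \<and> w_inner V w g g = 1}"
  \<comment> \<open>Besides scaling to norm 1, this resets the values outside \<open>V\<close> to 0,
    as membership in \<open>K\<close> demands; by \<open>local\<close> the values of
    \<open>T\<close> on \<open>V\<close> are not affected by the reset.\<close>
  define nrm where "nrm h = (\<lambda>v. if v \<in> V then (1 / sqrt (w_inner V w h h)) * h v else 0)" for h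
  \<comment> \<open>Taking both functions in \<open>linear\<close> to be \<open>g\<close> and the
    scalar to be \<open>c - 1\<close> extracts homogeneity.\<close>
  have T_scale: "T (\<lambda>u. c * g u) v = c * T g v" if "v \<in> V" for c g v
  proof -
    have "T (\<lambda>u. g u + (c - 1) * g u) v = T g v + (c - 1) * T g v"
      by (rule linear[OF that])
    then show ?thesis by (simp add: algebra_simps)
  qed
  have nrm_in: "nrm h \<in> K"
    and nrm_T: "w_inner V w (T (nrm h)) (nrm h) = w_inner V w (T h) h / w_inner V w h h"
    if h: "w_inner V w h (\<lambda>_. 1) = 0" and ne: "w_inner V w h h \<noteq> 0" for h
  proof -
    define c where "c = 1 / sqrt (w_inner V w h h)"
    have eq: "nrm h v = c * h v" if "v \<in> V" for v
      using that by (simp add: nrm_def c_def)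
    have "0 \<le> w_inner V w h h"
      using pos by (rule w_inner_self_nonneg)
    with ne have c2: "c * c = 1 / w_inner V w h h"
      by (simp add: c_def)
    have "w_inner V w (nrm h) (nrm h) = w_inner V w (\<lambda>v. c * h v) (\<lambda>v. c * h v)"
      using eq by (intro w_inner_cong)
    also have "\<dots> = c * c * w_inner V w h h"
      by (simp add: w_inner_simps)
    finally have "w_inner V w (nrm h) (nrm h) = 1"
      using c2 ne by simp
    moreover have "w_inner V w (nrm h) (\<lambda>_. 1) = 0"
    proof -
      have "w_inner V w (nrm h) (\<lambda>_. 1) = w_inner V w (\<lambda>v. c * h v) (\<lambda>_. 1)"
        using eq by (intro w_inner_cong) simp_all
      then show ?thesis using h by (simp add: w_inner_simps)
    qed
    ultimately show "nrm h \<in> K"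
      by (simp add: K_def nrm_def)
    have "w_inner V w (T (nrm h)) (nrm h) = w_inner V w (\<lambda>v. c * T h v) (\<lambda>v. c * h v)"
    proof (rule w_inner_cong)
      fix v assume "v \<in> V"
      have "T (nrm h) v = T (\<lambda>v. c * h v) v"
        using eq \<open>v \<in> V\<close> by (intro local)
      then show "T (nrm h) v = c * T h v"
        by (simp add: T_scale[OF \<open>v \<in> V\<close>])
    qed (use eq in simp)
    also have "\<dots> = c * c * w_inner V w (T h) h"
      by (simp add: w_inner_simps)
    finally show "w_inner V w (T (nrm h)) (nrm h) = w_inner V w (T h) h / w_inner V w h h"
      using c2 by simp
  qed
  have "compact K"
    unfolding K_def using fin pos by (rule compact_w_unit_sphere)
  moreover have "K \<noteq> {}"
    using nrm_in[OF f False] by blast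
  moreover have "continuous_on K (\<lambda>g. w_inner V w (T g) g)"
    by (rule continuous_on_subset[of UNIV])
       (auto intro!: continuous_on_w_inner cont)
  ultimately have "\<exists>g\<in>K. \<forall>h\<in>K. w_inner V w (T h) h \<le> w_inner V w (T g) g"
    by (rule continuous_attains_sup)
  then obtain g where g: "g \<in> K"
    and g_max: "\<And>h. h \<in> K \<Longrightarrow> w_inner V w (T h) h \<le> w_inner V w (T g) g"
    by blast
  define m where "m = w_inner V w (T g) g"
  \<comment> \<open>Both sides are homogeneous of degree 2, so the maximum on \<open>K\<close>
    bounds the form on the whole complement of the constants.\<close>
  have le_m: "w_inner V w (T h) h \<le> m * w_inner V w h h" if h: "w_inner V w h (\<lambda>_. 1) = 0" for h
  proof (cases "w_inner V w h h = 0")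
    case True
    then have "\<forall>v\<in>V. h v = 0"
      using w_inner_self_eq_0_iff[of V w, OF fin pos] by blast
    then have "w_inner V w (T h) h = 0"
      unfolding w_inner_def by simp
    with True show ?thesis by simp
  next
    case False
    have "0 \<le> w_inner V w h h"
      using pos by (rule w_inner_self_nonneg)
    with False have "0 < w_inner V w h h" by simp
    moreover have "w_inner V w (T h) h / w_inner V w h h \<le> m"
      using g_max[OF nrm_in[OF h False]] nrm_T[OF h False] by (simp add: m_def)
    ultimately show ?thesis by (simp add: field_simps)
  qed
  from g have g0: "w_inner V w g (\<lambda>_. 1) = 0" and g1: "w_inner V w g g = 1"
    by (simp_all add: K_def)
  \<comment> \<open>The residual of the eigenvalue equation for the maximiser; the goal is that it
    vanishes on \<open>V\<close>.\<close>
  define h where "h = (\<lambda>v. T g v + (- m) * g v)"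
  have h0: "w_inner V w h (\<lambda>_. 1) = 0"
    using g0 invariant[OF g0] unfolding h_def w_inner_simps by simp
  define c where "c = m * w_inner V w h h - w_inner V w (T h) h"
  \<comment> \<open>Perturb the maximiser in the direction \<open>h\<close> and apply
    \<open>le_m\<close>: the constant terms cancel, and the first-order terms combine to
    \<open>2 * t * w_inner V w h h\<close>.\<close>
  have variation: "2 * t * w_inner V w h h \<le> t * t * c" for t
  proof -
    have "w_inner V w (\<lambda>v. g v + t * h v) (\<lambda>_. 1) = 0"
      using g0 h0 by (simp add: w_inner_simps)
    then have "w_inner V w (T (\<lambda>v. g v + t * h v)) (\<lambda>v. g v + t * h v)
        \<le> m * w_inner V w (\<lambda>v. g v + t * h v) (\<lambda>v. g v + t * h v)"
      by (rule le_m)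
    moreover have "w_inner V w (T (\<lambda>v. g v + t * h v)) (\<lambda>v. g v + t * h v)
        = m + 2 * t * w_inner V w (T g) h + t * t * w_inner V w (T h) h"
    proof -
      have "w_inner V w (T (\<lambda>v. g v + t * h v)) (\<lambda>v. g v + t * h v)
          = w_inner V w (\<lambda>v. T g v + t * T h v) (\<lambda>v. g v + t * h v)"
        by (rule w_inner_cong) (simp_all add: linear)
      moreover have "w_inner V w (T h) g = w_inner V w (T g) h"
        using selfadj[of h g] w_inner_commute[of V w h] by simp
      ultimately show ?thesis
        by (simp add: w_inner_simps m_def algebra_simps)
    qed
    moreover have "w_inner V w (\<lambda>v. g v + t * h v) (\<lambda>v. g v + t * h v)
        = 1 + 2 * t * w_inner V w g h + t * t * w_inner V w h h"
      using g1 w_inner_commute[of V w h g] by (simp add: w_inner_simps algebra_simps)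
    moreover have "2 * t * w_inner V w h h
        = 2 * t * w_inner V w (T g) h - 2 * t * (m * w_inner V w g h)"
    proof -
      have "w_inner V w h h = w_inner V w (T g) h + (- m) * w_inner V w g h"
        by (subst (1) h_def) (simp only: w_inner_simps)
      then show ?thesis by (simp only:) (simp add: algebra_simps)
    qed
    ultimately show ?thesis
      unfolding c_def by (simp only: algebra_simps)
  qed
  have "w_inner V w h h = 0"
  proof (rule ccontr)
    assume "w_inner V w h h \<noteq> 0"
    moreover have "0 \<le> w_inner V w h h"
      using pos by (rule w_inner_self_nonneg)
    ultimately have p: "0 < w_inner V w h h" by simp
    \<comment> \<open>A step so short that the quadratic term cannot absorb the linear one; the
      summand 1 keeps the denominator positive.\<close>
    define t where "t = w_inner V w h h / (\<bar>c\<bar> + 1)"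
    have "0 < t" using p by (simp add: t_def)
    with variation[of t] have "2 * w_inner V w h h \<le> t * c"
      by (simp add: mult.assoc mult.left_commute)
    also have "\<dots> \<le> t * (\<bar>c\<bar> + 1)"
      using \<open>0 < t\<close> by (intro mult_left_mono) auto
    also have "\<dots> = w_inner V w h h"
      by (simp add: t_def)
    finally show False using p by simp
  qed
  then have "\<forall>v\<in>V. h v = 0"
    using w_inner_self_eq_0_iff[of V w, OF fin pos] by blast
  then have "\<forall>v\<in>V. T g v = m * g v"
    by (simp add: h_def)
  moreover have "\<exists>v\<in>V. g v \<noteq> 0"
    using g1 w_inner_self_eq_0_iff[of V w g, OF fin pos] by auto
  ultimately have "m \<le> lam"
    using eig g0 by blast
  then have "m * w_inner V w f f \<le> lam * w_inner V w f f"
    using w_inner_self_nonneg[of V w f, OF pos] by (rule mult_right_mono)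
  then show ?thesis
    using le_m[OF f] by linarith
qed

section \<open>Incidence of vertices and edges\<close>

text \<open>Vertices are singleton faces, and closure under subsets puts both singletons below an
  edge into \<open>X\<close>. The last clause turns sums over the ends of an edge into sums of two
  terms.\<close>

lemma edge_cases:
  assumes "is_graph X" and "e \<in> faces X 1"
  obtains x y where "x \<noteq> y" "e = {x, y}" "{x} \<in> faces X 0" "{y} \<in> faces X 0"
    "{v \<in> faces X 0. v \<subseteq> e} = {{x}, {y}}"
proof -
  have "card e = 2" and "e \<in> X"
    using assms(2) by (simp_all add: faces_def)
  then obtain x y where xy: "x \<noteq> y" "e = {x, y}"
    by (metis card_2_iff)
  have sub: "z \<subseteq> e \<Longrightarrow> z \<in> X" for z
    using assms(1) \<open>e \<in> X\<close> unfolding is_graph_def by blast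
  then have mem: "{x} \<in> faces X 0" "{y} \<in> faces X 0"
    using xy by (auto simp: faces_def)
  have "v = {x} \<or> v = {y}" if "v \<in> faces X 0" "v \<subseteq> e" for v
  proof -
    from that(1) obtain z where "v = {z}"
      by (auto simp: faces_def card_1_singleton_iff)
    with that(2) xy show ?thesis by auto
  qed
  with mem xy have "{v \<in> faces X 0. v \<subseteq> e} = {{x}, {y}}" by auto
  with that xy mem show thesis by blast
qed

lemma finite_faces: "is_graph X \<Longrightarrow> finite (faces X i)"
  unfolding is_graph_def faces_def by simp

lemma weighted_graph_imp_is_graph: "weighted_graph X w \<Longrightarrow> is_graph X"
  unfolding weighted_graph_def by blast

lemma weighted_graph_finite_faces: "weighted_graph X w \<Longrightarrow> finite (faces X i)"
  by (intro finite_faces weighted_graph_imp_is_graph)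

lemma vertex_weight_pos: "weighted_graph X w \<Longrightarrow> v \<in> faces X 0 \<Longrightarrow> 0 < w v"
  unfolding weighted_graph_def by blast

lemma sum_edge_weight_eq_1: "weighted_graph X w \<Longrightarrow> (\<Sum>e\<in>faces X 1. w e) = 1"
  unfolding weighted_graph_def by blast

lemma weight_nonneg: "weighted_graph X w \<Longrightarrow> x \<in> faces X i \<Longrightarrow> 0 \<le> w x"
  unfolding weighted_graph_def faces_def by blast

text \<open>The map sending \<open>v\<close> to \<open>e - v\<close> exchanges the two ends of
  \<open>e\<close>.\<close>

lemma edge_sum_swap:
  assumes "is_graph X" and "e \<in> faces X 1"
  shows "(\<Sum>v | v \<in> faces X 0 \<and> v \<subseteq> e. h (e - v) v) = (\<Sum>v | v \<in> faces X 0 \<and> v \<subseteq> e. h v (e - v))"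
proof -
  obtain x y where xy: "x \<noteq> y" "e = {x, y}"
    and mem: "{x} \<in> faces X 0" "{y} \<in> faces X 0"
    and V: "{v \<in> faces X 0. v \<subseteq> e} = {{x}, {y}}"
    by (rule edge_cases[OF assms])
  have "e - {x} = {y}" "e - {y} = {x}"
    using xy by auto
  then show ?thesis
    unfolding V using xy(1) by (simp add: add.commute)
qed

text \<open>Ensures that \<open>adjacency_op\<close> at a vertex evaluates its argument only at
  vertices, so that values elsewhere do not matter.\<close>

lemma minus_vertex_in_faces:
  assumes "is_graph X" and "e \<in> faces X 1" and "v \<in> faces X 0" and "v \<subseteq> e"
  shows "e - v \<in> faces X 0"
proof -
  obtain x y where xy: "x \<noteq> y" "e = {x, y}"
    and mem: "{x} \<in> faces X 0" "{y} \<in> faces X 0"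
    and V: "{v \<in> faces X 0. v \<subseteq> e} = {{x}, {y}}"
    by (rule edge_cases[OF assms(1,2)])
  have "v \<in> {{x}, {y}}"
    unfolding V[symmetric] using assms(3,4) by simp
  moreover have "e - {x} = {y}" "e - {y} = {x}"
    using xy by auto
  ultimately show ?thesis using mem by (metis insertE empty_iff)
qed

lemma sum_vertices_edges:
  assumes "is_graph X"
  shows "(\<Sum>v\<in>faces X 0. \<Sum>e | e \<in> faces X 1 \<and> v \<subseteq> e. h v e) =
    (\<Sum>e\<in>faces X 1. \<Sum>v | v \<in> faces X 0 \<and> v \<subseteq> e. h v e)"
  using finite_faces[OF assms] by (intro sum.swap_restrict)

lemma vertex_weight:
  assumes "weighted_graph X w" and "v \<in> faces X 0"
  shows "w v = 1 / 2 * (\<Sum>e | e \<in> faces X 1 \<and> v \<subseteq> e. w e)"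
  using assms unfolding weighted_graph_def by blast

text \<open>Replace \<open>w v\<close> by half the weight of the edges at \<open>v\<close> and count
  incident pairs edge by edge.\<close>

lemma sum_vertex_weight:
  assumes "weighted_graph X w"
  shows "(\<Sum>v\<in>faces X 0. w v * h v) =
    1 / 2 * (\<Sum>e\<in>faces X 1. w e * (\<Sum>v | v \<in> faces X 0 \<and> v \<subseteq> e. h v))"
proof -
  have gr: "is_graph X" using assms by (rule weighted_graph_imp_is_graph)
  have "(\<Sum>v\<in>faces X 0. w v * h v) =
      (\<Sum>v\<in>faces X 0. \<Sum>e | e \<in> faces X 1 \<and> v \<subseteq> e. 1 / 2 * (w e * h v))"
    by (rule sum.cong[OF refl], subst vertex_weight[OF assms])
       (auto simp: sum_distrib_left sum_distrib_right mult.assoc)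
  also have "\<dots> = 1 / 2 * (\<Sum>e\<in>faces X 1. w e * (\<Sum>v | v \<in> faces X 0 \<and> v \<subseteq> e. h v))"
    unfolding sum_vertices_edges[OF gr] by (simp add: sum_distrib_left)
  finally show ?thesis .
qed

section \<open>The adjacency operator\<close>

text \<open>The positive weight \<open>w v\<close> cancels against the denominator
  \<open>2 * w v\<close>, leaving a sum in which every edge contributes once for each end.\<close>

lemma w_inner_adjacency_op:
  assumes "weighted_graph X w"
  shows "w_inner (faces X 0) w (adjacency_op X w f) g =
    1 / 2 * (\<Sum>e\<in>faces X 1. w e * (\<Sum>v | v \<in> faces X 0 \<and> v \<subseteq> e. f (e - v) * g v))"
proof -
  have gr: "is_graph X" using assms by (rule weighted_graph_imp_is_graph)
  have pos: "0 < w v" if "v \<in> faces X 0" for v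
    using assms that by (rule vertex_weight_pos)
  have "w_inner (faces X 0) w (adjacency_op X w f) g =
      (\<Sum>v\<in>faces X 0. \<Sum>e | e \<in> faces X 1 \<and> v \<subseteq> e. 1 / 2 * (w e * (f (e - v) * g v)))"
    unfolding w_inner_def adjacency_op_def sum_distrib_left sum_distrib_right
    by (intro sum.cong refl) (use pos in \<open>force simp: field_simps\<close>)
  also have "\<dots> = 1 / 2 * (\<Sum>e\<in>faces X 1. w e * (\<Sum>v | v \<in> faces X 0 \<and> v \<subseteq> e. f (e - v) * g v))"
    unfolding sum_vertices_edges[OF gr] by (simp add: sum_distrib_left)
  finally show ?thesis .
qed

lemma adjacency_op_linear:
  "adjacency_op X w (\<lambda>u. f u + c * g u) v = adjacency_op X w f v + c * adjacency_op X w g v"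
  unfolding adjacency_op_def
  by (simp add: sum_distrib_left sum.distrib[symmetric] algebra_simps)

text \<open>In the edge form of the inner product, exchanging the ends of each edge interchanges the
  roles of \<open>f\<close> and \<open>g\<close>.\<close>

lemma adjacency_op_selfadjoint:
  assumes "weighted_graph X w"
  shows "w_inner (faces X 0) w (adjacency_op X w f) g = w_inner (faces X 0) w f (adjacency_op X w g)"
proof -
  have gr: "is_graph X" using assms by (rule weighted_graph_imp_is_graph)
  have "(\<Sum>v | v \<in> faces X 0 \<and> v \<subseteq> e. f (e - v) * g v) =
      (\<Sum>v | v \<in> faces X 0 \<and> v \<subseteq> e. g (e - v) * f v)" if "e \<in> faces X 1" for e
    using edge_sum_swap[OF gr that, of "\<lambda>u v. f u * g v"] by (simp add: mult.commute)
  then show ?thesis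
    unfolding w_inner_commute[of _ _ f] w_inner_adjacency_op[OF assms] by simp
qed

text \<open>Exchanging the ends moves \<open>f\<close> from \<open>e - v\<close> to
  \<open>v\<close>, and what remains is the weighted sum of \<open>f\<close> itself. In particular
  the operator preserves the complement of the constants.\<close>

lemma adjacency_op_w_inner_1:
  assumes "weighted_graph X w"
  shows "w_inner (faces X 0) w (adjacency_op X w f) (\<lambda>_. 1) = w_inner (faces X 0) w f (\<lambda>_. 1)"
proof -
  have gr: "is_graph X" using assms by (rule weighted_graph_imp_is_graph)
  have "w_inner (faces X 0) w (adjacency_op X w f) (\<lambda>_. 1) =
      1 / 2 * (\<Sum>e\<in>faces X 1. w e * (\<Sum>v | v \<in> faces X 0 \<and> v \<subseteq> e. f v))"
    unfolding w_inner_adjacency_op[OF assms]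
    using edge_sum_swap[OF gr, of _ "\<lambda>u v. f u"] by simp
  also have "\<dots> = w_inner (faces X 0) w f (\<lambda>_. 1)"
    unfolding w_inner_def using sum_vertex_weight[OF assms, of f] by simp
  finally show ?thesis .
qed

text \<open>Every edge has two ends, which cancels the factor 1/2 in the vertex weights and leaves
  the total edge weight.\<close>

lemma sum_vertex_weight_eq_1:
  assumes "weighted_graph X w"
  shows "(\<Sum>v\<in>faces X 0. w v) = 1"
proof -
  have gr: "is_graph X" using assms by (rule weighted_graph_imp_is_graph)
  have "(\<Sum>v | v \<in> faces X 0 \<and> v \<subseteq> e. 1 :: real) = 2" if e: "e \<in> faces X 1" for e
  proof -
    obtain x y where xy: "x \<noteq> y" "e = {x, y}"
      and mem: "{x} \<in> faces X 0" "{y} \<in> faces X 0"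
      and V: "{v \<in> faces X 0. v \<subseteq> e} = {{x}, {y}}"
      by (rule edge_cases[OF gr e])
    from xy(1) show ?thesis unfolding V by simp
  qed
  then have "(\<Sum>v\<in>faces X 0. w v) = (\<Sum>e\<in>faces X 1. w e)"
    using sum_vertex_weight[OF assms, of "\<lambda>_. 1"] by (simp add: sum_distrib_left mult.commute)
  then show ?thesis using sum_edge_weight_eq_1[OF assms] by simp
qed

text \<open>Passes from the eigenvalue bound in the definition of an expander to a bound on the
  quadratic form.\<close>

lemma adjacency_op_rayleigh_le:
  assumes wg: "weighted_graph X w" and ex: "expander \<mu> lam X w"
    and f: "w_inner (faces X 0) w f (\<lambda>_. 1) = 0"
  shows "w_inner (faces X 0) w (adjacency_op X w f) f \<le> lam * w_inner (faces X 0) w f f"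
proof (rule rayleigh_le[OF _ _ _ _ _ _ _ _ f])
  have gr: "is_graph X" using wg by (rule weighted_graph_imp_is_graph)
  show "finite (faces X 0)" using gr by (rule finite_faces)
  show "0 < w v" if "v \<in> faces X 0" for v
    using wg that by (rule vertex_weight_pos)
  \<comment> \<open>For fixed \<open>v\<close> this is a linear combination of coordinate
    evaluations, hence continuous in the product topology.\<close>
  show "continuous_on UNIV (\<lambda>f. adjacency_op X w f v)" for v
    unfolding adjacency_op_def by (intro continuous_intros continuous_on_product_coordinates)
  show "adjacency_op X w f v = adjacency_op X w g v"
    if "\<And>u. u \<in> faces X 0 \<Longrightarrow> f u = g u" "v \<in> faces X 0" for f g v
    unfolding adjacency_op_def
    by (rule sum.cong) (use minus_vertex_in_faces[OF gr] that in auto)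
  show "adjacency_op X w (\<lambda>u. f u + c * g u) v = adjacency_op X w f v + c * adjacency_op X w g v"
    for f g c v by (rule adjacency_op_linear)
  show "w_inner (faces X 0) w (adjacency_op X w f) g = w_inner (faces X 0) w f (adjacency_op X w g)"
    for f g using wg by (rule adjacency_op_selfadjoint)
  show "w_inner (faces X 0) w (adjacency_op X w f) (\<lambda>_. 1) = 0"
    if "w_inner (faces X 0) w f (\<lambda>_. 1) = 0" for f
    using that adjacency_op_w_inner_1[OF wg] by simp
  show "\<theta> \<le> lam"
    if "w_inner (faces X 0) w f (\<lambda>_. 1) = 0" "\<exists>v\<in>faces X 0. f v \<noteq> 0"
      "\<forall>v\<in>faces X 0. adjacency_op X w f v = \<theta> * f v" for \<theta> f
  proof -
    have "adjacency_eigenvalue_on_C0_circ X w \<theta>"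
      using that unfolding adjacency_eigenvalue_on_C0_circ_def C0_circ_def w_inner_def by auto
    then show ?thesis using ex by (simp add: expander_def)
  qed
qed

text \<open>A one-sided expander mixing estimate: split the indicator of \<open>A\<close> into its
  mean \<open>p\<close> and a part orthogonal to the constants. The constant part contributes
  \<open>p^2\<close>, and the Rayleigh bound controls the rest, whose squared norm is
  \<open>p - p^2\<close>.\<close>

lemma mixing_bound:
  assumes wg: "weighted_graph X w" and ex: "expander \<mu> lam X w"
    and p: "p = (\<Sum>v | v \<in> faces X 0 \<and> v \<in> A. w v)"
  shows "w_inner (faces X 0) w (adjacency_op X w (indicator A)) (indicator A) \<le> p\<^sup>2 + lam * (p - p\<^sup>2)"
proof -
  let ?ip = "w_inner (faces X 0) w"
  let ?T = "adjacency_op X w"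
  \<comment> \<open>Since the total vertex weight is 1, subtracting \<open>p\<close> projects away
    from the constants. The factor 1 lets the scaling rules for \<open>w_inner\<close>
    match.\<close>
  let ?g = "\<lambda>v. indicator A v + (- p) * 1 :: real"
  have fin: "finite (faces X 0)"
    using wg by (rule weighted_graph_finite_faces)
  have p_eq: "p = (\<Sum>v\<in>faces X 0. if v \<in> A then w v else 0)"
    unfolding p using fin by (rule sum.inter_filter)
  have p1: "?ip (indicator A) (\<lambda>_. 1) = p" and pA: "?ip (indicator A) (indicator A) = p"
    unfolding w_inner_def p_eq by (intro sum.cong refl; simp add: indicator_def)+
  have one: "?ip (\<lambda>_. 1) (\<lambda>_. 1) = 1"
    unfolding w_inner_def using sum_vertex_weight_eq_1[OF wg] by simp
  have p1': "?ip (\<lambda>_. 1) (indicator A) = p"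
    unfolding p1[symmetric] by (rule w_inner_commute)
  have g0: "?ip ?g (\<lambda>_. 1) = 0"
    unfolding w_inner_add_left w_inner_scale_left p1 one by simp
  have g2: "?ip ?g ?g = p - p\<^sup>2"
    unfolding w_inner_add_right w_inner_scale_right g0
    unfolding w_inner_add_left w_inner_scale_left pA p1'
    by (simp add: power2_eq_square)
  have Tg: "?T ?g = (\<lambda>v. ?T (indicator A) v + (- p) * ?T (\<lambda>_. 1) v)"
    by (intro ext adjacency_op_linear)
  \<comment> \<open>By self-adjointness the image of the constant 1 pairs with \<open>f\<close> like
    1 itself, which suffices without computing it pointwise.\<close>
  have T1: "?ip (?T (\<lambda>_. 1)) f = ?ip f (\<lambda>_. 1)" for f
    unfolding adjacency_op_selfadjoint[OF wg]
    by (subst w_inner_commute) (rule adjacency_op_w_inner_1[OF wg])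
  have "?ip (?T ?g) ?g = ?ip (?T (indicator A)) ?g + (- p) * ?ip (?T (\<lambda>_. 1)) ?g"
    unfolding Tg by (simp only: w_inner_add_left[of _ _ "?T (indicator A)"] w_inner_scale_left[of _ _ _ "?T _"])
  \<comment> \<open>The second term is a multiple of the pairing of \<open>?g\<close> with 1, which
    is 0.\<close>
  also have "\<dots> = ?ip (?T (indicator A)) ?g"
    unfolding T1 g0 by simp
  also have "\<dots> = ?ip (?T (indicator A)) (indicator A) - p * ?ip (?T (indicator A)) (\<lambda>_. 1)"
    unfolding w_inner_add_right w_inner_scale_right by simp
  also have "\<dots> = ?ip (?T (indicator A)) (indicator A) - p\<^sup>2"
    by (simp add: adjacency_op_w_inner_1[OF wg] p1 power2_eq_square)
  finally show ?thesis
    using adjacency_op_rayleigh_le[OF wg ex g0] g2 by simp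
qed

section \<open>Coboundaries and level sets\<close>

text \<open>Resolves the definite descriptions: reflexivity compares each end with itself, and
  antisymmetry gives uniqueness.\<close>

lemma larger_smaller_vertex:
  assumes ord: "linear_order_on (faces X 0) r" and "a \<noteq> b" and "(a, b) \<in> r"
    and V: "{v \<in> faces X 0. v \<subseteq> e} = {a, b}"
  shows "larger_vertex X r e = b" "smaller_vertex X r e = a"
proof -
  have V': "v \<in> faces X 0 \<and> v \<subseteq> e \<longleftrightarrow> v = a \<or> v = b" for v
    using V by blast
  have "refl_on (faces X 0) r"
    using ord unfolding order_on_defs by blast
  then have refl: "(a, a) \<in> r" "(b, b) \<in> r"
    using V' by (metis refl_onD)+
  have anti: "(b, a) \<notin> r"
    using ord \<open>a \<noteq> b\<close> \<open>(a, b) \<in> r\<close> unfolding order_on_defs by (auto dest: antisymD)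
  show "larger_vertex X r e = b"
    unfolding larger_vertex_def
  proof (rule the_equality)
    show "b \<in> faces X 0 \<and> b \<subseteq> e \<and> (\<forall>u\<in>faces X 0. u \<subseteq> e \<longrightarrow> (u, b) \<in> r)"
      using V' refl \<open>(a, b) \<in> r\<close> by metis
    show "v = b" if "v \<in> faces X 0 \<and> v \<subseteq> e \<and> (\<forall>u\<in>faces X 0. u \<subseteq> e \<longrightarrow> (u, v) \<in> r)" for v
      using that V' anti by metis
  qed
  show "smaller_vertex X r e = a"
    unfolding smaller_vertex_def
  proof (rule the_equality)
    show "a \<in> faces X 0 \<and> a \<subseteq> e \<and> (\<forall>u\<in>faces X 0. u \<subseteq> e \<longrightarrow> (a, u) \<in> r)"
      using V' refl \<open>(a, b) \<in> r\<close> by metis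
    show "v = a" if "v \<in> faces X 0 \<and> v \<subseteq> e \<and> (\<forall>u\<in>faces X 0. u \<subseteq> e \<longrightarrow> (v, u) \<in> r)" for v
      using that V' anti by metis
  qed
qed

text \<open>Reversing the order of the two ends only changes the sign of \<open>d0\<close>, so its
  vanishing is independent of the orientation; totality ensures that one of the two orders
  occurs.\<close>

lemma d0_eq_0_iff:
  assumes ord: "linear_order_on (faces X 0) r" and "a \<noteq> b"
    and V: "{v \<in> faces X 0. v \<subseteq> e} = {a, b}"
  shows "d0 X r f e = 0 \<longleftrightarrow> f a = f b"
proof -
  have "a \<in> faces X 0" "b \<in> faces X 0"
    using V by blast+
  then have "(a, b) \<in> r \<or> (b, a) \<in> r"
    using ord \<open>a \<noteq> b\<close> unfolding order_on_defs total_on_def by blast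
  then show ?thesis
  proof
    assume "(a, b) \<in> r"
    then show ?thesis
      using larger_smaller_vertex[OF ord \<open>a \<noteq> b\<close> _ V] by (auto simp: d0_def)
  next
    assume "(b, a) \<in> r"
    moreover have "{v \<in> faces X 0. v \<subseteq> e} = {b, a}"
      using V by blast
    ultimately show ?thesis
      using larger_smaller_vertex[OF ord \<open>a \<noteq> b\<close>[symmetric]] by (simp add: d0_def)
  qed
qed

text \<open>The constant cochain with value \<open>c\<close> is one competitor in the minimum;
  subtracting it leaves a cochain supported off the level set of \<open>c\<close>.\<close>

lemma dist_B0_le:
  fixes f :: "'a set \<Rightarrow> 'r::ab_group_add"
  assumes wg: "weighted_graph X w"
  shows "dist_B0 X w f \<le> 1 - (\<Sum>v | v \<in> faces X 0 \<and> f v = c. w v)"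
proof -
  have fin: "finite (faces X 0)"
    using wg by (rule weighted_graph_finite_faces)
  \<comment> \<open>Every norm is the weight of some set of vertices, so \<open>Min\<close> ranges
    over finitely many values even if \<open>'r\<close> is infinite.\<close>
  have "(\<lambda>g. wnorm X w 0 (\<lambda>v. f v - g v)) ` B0 X \<subseteq> sum w ` Pow (faces X 0)"
    unfolding wnorm_def by auto
  then have "finite ((\<lambda>g. wnorm X w 0 (\<lambda>v. f v - g v)) ` B0 X)"
    using fin by (meson finite_Pow_iff finite_imageI finite_subset)
  moreover have "(\<lambda>_. c) \<in> B0 X"
    by (auto simp: B0_def)
  ultimately have "dist_B0 X w f \<le> wnorm X w 0 (\<lambda>v. f v - c)"
    unfolding dist_B0_def by (intro Min_le) auto
  also have "\<dots> = 1 - (\<Sum>v | v \<in> faces X 0 \<and> f v = c. w v)"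
  proof -
    have "{v \<in> faces X 0. f v - c \<noteq> 0} = faces X 0 - {v. v \<in> faces X 0 \<and> f v = c}"
      by auto
    then show ?thesis
      unfolding wnorm_def using fin sum_vertex_weight_eq_1[OF wg]
      by (simp add: sum_diff)
  qed
  finally show ?thesis .
qed

text \<open>An end \<open>v\<close> of an edge is counted at level \<open>c\<close> exactly when
  both ends have value \<open>c\<close>. So an edge on which \<open>f\<close> agrees is counted
  twice, compensating the factor 1/2, and any other edge not at all.\<close>

lemma sum_level_sets_adjacency:
  fixes f :: "'a set \<Rightarrow> 'r::ab_group_add"
  assumes wg: "weighted_graph X w" and ord: "linear_order_on (faces X 0) r"
  shows "(\<Sum>c\<in>f ` faces X 0. w_inner (faces X 0) w
      (adjacency_op X w (indicator {v. f v = c})) (indicator {v. f v = c})) = 1 - wnorm X w 1 (d0 X r f)"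
proof -
  let ?I = "\<lambda>c. indicator {v. f v = c} :: 'a set \<Rightarrow> real"
  have gr: "is_graph X" using wg by (rule weighted_graph_imp_is_graph)
  have fin: "finite (faces X 0)" "finite (faces X 1)"
    using gr by (rule finite_faces)+
  \<comment> \<open>Only the level \<open>c = f v\<close> can contribute, and it occurs in the range
    because \<open>v\<close> is a vertex.\<close>
  have level: "(\<Sum>c\<in>f ` faces X 0. ?I c u * ?I c v) = of_bool (f u = f v)"
    if "v \<in> faces X 0" for u v
  proof -
    have "(\<Sum>c\<in>f ` faces X 0. ?I c u * ?I c v) = (\<Sum>c\<in>f ` faces X 0. if c = f v then of_bool (f u = f v) else 0)"
      by (rule sum.cong) (auto simp: indicator_def)
    also have "\<dots> = of_bool (f u = f v)"
      using fin that by (subst sum.delta) auto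
    finally show ?thesis .
  qed
  have edge: "(\<Sum>v | v \<in> faces X 0 \<and> v \<subseteq> e. of_bool (f (e - v) = f v)) = 2 * (of_bool (d0 X r f e = 0) :: real)"
    if e: "e \<in> faces X 1" for e
  proof -
    obtain x y where xy: "x \<noteq> y" "e = {x, y}"
      and mem: "{x} \<in> faces X 0" "{y} \<in> faces X 0"
      and V: "{v \<in> faces X 0. v \<subseteq> e} = {{x}, {y}}"
      by (rule edge_cases[OF gr e])
    have "e - {x} = {y}" "e - {y} = {x}"
      using xy by auto
    then show ?thesis
      using xy(1) d0_eq_0_iff[OF ord _ V, of f] unfolding V by auto
  qed
  have "(\<Sum>c\<in>f ` faces X 0. w_inner (faces X 0) w (adjacency_op X w (?I c)) (?I c)) =
      1 / 2 * (\<Sum>c\<in>f ` faces X 0. \<Sum>e\<in>faces X 1. w e *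
        (\<Sum>v | v \<in> faces X 0 \<and> v \<subseteq> e. ?I c (e - v) * ?I c v))"
    unfolding w_inner_adjacency_op[OF wg] sum_distrib_left by simp
  also have "\<dots> = 1 / 2 * (\<Sum>e\<in>faces X 1. w e *
        (\<Sum>v | v \<in> faces X 0 \<and> v \<subseteq> e. \<Sum>c\<in>f ` faces X 0. ?I c (e - v) * ?I c v))"
    by (subst sum.swap, subst sum.swap[of _ _ "f ` faces X 0"]) (simp add: sum_distrib_left)
  also have "\<dots> = 1 / 2 * (\<Sum>e\<in>faces X 1. w e * (2 * of_bool (d0 X r f e = 0)))"
    using level edge by simp
  also have "\<dots> = (\<Sum>e\<in>faces X 1. w e - w e * of_bool (d0 X r f e \<noteq> 0))"
    unfolding sum_distrib_left by (rule sum.cong) auto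
  also have "\<dots> = 1 - wnorm X w 1 (d0 X r f)"
  proof -
    have "wnorm X w 1 (d0 X r f) = (\<Sum>e\<in>faces X 1. w e * of_bool (d0 X r f e \<noteq> 0))"
      unfolding wnorm_def using fin(2)
      by (simp add: sum.inter_filter of_bool_def if_distrib cong: if_cong)
    then show ?thesis using sum_edge_weight_eq_1[OF wg] by (simp add: sum_subtractf)
  qed
  finally show ?thesis .
qed

section \<open>The expansion bound\<close>

lemma wnorm_nonneg:
  assumes "weighted_graph X w"
  shows "0 \<le> wnorm X w i f"
  using weight_nonneg[OF assms] unfolding wnorm_def by (intro sum_nonneg) auto

lemma wnorm_d0_ge:
  fixes f :: "'a set \<Rightarrow> 'r::ab_group_add"
  assumes wg: "weighted_graph X w" and ex: "expander \<mu> lam X w"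
    and ord: "linear_order_on (faces X 0) r" and "lam \<le> 1"
  shows "(1 - lam) * dist_B0 X w f \<le> wnorm X w 1 (d0 X r f)"
proof -
  define p where "p c = (\<Sum>v | v \<in> faces X 0 \<and> f v = c. w v)" for c
  \<comment> \<open>The probability that two independent vertices, drawn with weights
    \<open>w\<close>, fall into the same level set.\<close>
  define S where "S = (\<Sum>c\<in>f ` faces X 0. (p c)\<^sup>2)"
  have fin: "finite (faces X 0)"
    using wg by (rule weighted_graph_finite_faces)
  have sum_p: "(\<Sum>c\<in>f ` faces X 0. p c) = 1"
    unfolding p_def using sum.image_gen[OF fin, of w f] sum_vertex_weight_eq_1[OF wg] by simp
  have p_nonneg: "0 \<le> p c" for c
    unfolding p_def using weight_nonneg[OF wg] by (intro sum_nonneg) auto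
  \<comment> \<open>In each square one factor is bounded by \<open>1 - dist_B0 X w f\<close>; the
    other factors sum to 1.\<close>
  have "S \<le> (\<Sum>c\<in>f ` faces X 0. (1 - dist_B0 X w f) * p c)"
    unfolding S_def
  proof (rule sum_mono)
    fix c
    have "p c \<le> 1 - dist_B0 X w f"
      using dist_B0_le[OF wg, of f c] by (simp add: p_def)
    then show "(p c)\<^sup>2 \<le> (1 - dist_B0 X w f) * p c"
      using p_nonneg by (simp add: power2_eq_square mult_right_mono)
  qed
  also have "\<dots> = 1 - dist_B0 X w f"
    using sum_p by (simp add: sum_distrib_left[symmetric])
  finally have S_le: "dist_B0 X w f \<le> 1 - S" by simp
  have "1 - wnorm X w 1 (d0 X r f) \<le> (\<Sum>c\<in>f ` faces X 0. (p c)\<^sup>2 + lam * (p c - (p c)\<^sup>2))"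
    unfolding sum_level_sets_adjacency[OF wg ord, symmetric]
    by (intro sum_mono mixing_bound[OF wg ex]) (simp add: p_def)
  also have "\<dots> = S + lam * (1 - S)"
    by (simp add: sum.distrib sum_distrib_left[symmetric] sum_subtractf sum_p S_def)
  finally have "(1 - lam) * (1 - S) \<le> wnorm X w 1 (d0 X r f)"
    by (simp add: algebra_simps)
  \<comment> \<open>Here \<open>lam \<le> 1\<close> makes the factor \<open>1 - lam\<close>
    nonnegative, so \<open>S_le\<close> may be multiplied by it.\<close>
  moreover have "(1 - lam) * dist_B0 X w f \<le> (1 - lam) * (1 - S)"
    using S_le \<open>lam \<le> 1\<close> by (intro mult_left_mono) auto
  ultimately show ?thesis by linarith
qed

theorem corollary5p3:
  fixes X :: "'a set set" and w :: "'a set \<Rightarrow> real" and r :: "'a set rel" and lam :: real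
  assumes "weighted_graph X w"
    and "expander (-1) lam X w"
    and "linear_order_on (faces X 0) r"
    and "\<exists>x :: 'r::ab_group_add. x \<noteq> 0"
  shows "cbe0 X w r TYPE('r) \<ge> ereal (1 - lam)"
proof -
  \<comment> \<open>Admissible constants are nonnegative, so the witness is cut off at 0; this only
    matters when \<open>lam > 1\<close>.\<close>
  define \<epsilon> where "\<epsilon> = max 0 (1 - lam)"
  have "\<epsilon> * dist_B0 X w f \<le> wnorm X w 1 (d0 X r f)" for f :: "'a set \<Rightarrow> 'r"
  proof (cases "lam \<le> 1")
    case True
    then show ?thesis
      using wnorm_d0_ge[OF assms(1-3) True, of f] by (simp add: \<epsilon>_def)
  next
    case False
    then show ?thesis
      using wnorm_nonneg[OF assms(1), of 1 "d0 X r f"] by (simp add: \<epsilon>_def)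
  qed
  then have "ereal \<epsilon> \<le> cbe0 X w r TYPE('r)"
    unfolding cbe0_def using max.cobounded1[of 0 "1 - lam", folded \<epsilon>_def]
    by (intro Sup_upper) blast
  then show ?thesis
    by (rule order_trans[rotated]) (simp add: \<epsilon>_def)
qed

end
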